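(* Let $c<0$ and $\kappa>0$. If $$2u_p'(1)+(2-\cos\alpha-\beta)\,(u_p(1)-1)\le \cos\alpha-\beta,$$ then the function $z\mapsto z\,u_p(z)$ belongs to the class $\mathcal{SP}_p(\alpha,\beta)$.
   Context: Throughout, $\alpha,\beta$ are real with $|\alpha|<\pi/2$ and $0\le\beta<1$. Let $\mathbb{U}=\{z\in\mathbb{C}:|z|<1\}$ and let $\mathcal{A}$ be the class of functions analytic in $\mathbb{U}$ of the form $f(z)=z+\sum_{n=2}^{\infty}a_nz^n$. A function $f\in\mathcal{A}$ belongs to $\mathcal{SP}_p(\alpha,\beta)$ if $\operatorname{Re}\left\{e^{-i\alpha}\frac{zf'(z)}{f(z)}\right\}>\left|\frac{zf'(z)}{f(z)}-1\right|+\beta$ for all $z\in\mathbb{U}$ (the quotient being read as its limit $1$ at $z=0$); the subscript $p$ in the name $\mathcal{SP}_p$ is only part of the notation. The generalized normalized Bessel function with parameters $p,b,c$ is the entire function $u_p(z)=\sum_{n=0}^{\infty}\frac{(-c/4)^n}{(\kappa)_n\,n!}z^n$, where $\kappa=p+(b+1)/2\ne 0,-1,-2,\ldots$ and $(a)_0=1$, $(a)_n=a(a+1)\cdots(a+n-1)$ for $n\ge1$. *)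

theory Defs
  imports "HOL-Analysis.Analysis"
begin

abbreviation unit_disc :: "complex set" where
  "unit_disc \<equiv> ball 0 1"

definition class_A :: "(complex \<Rightarrow> complex) set" where
  "class_A = {f. f analytic_on unit_disc \<and>
     (\<exists>a. \<forall>z\<in>unit_disc. (\<lambda>n. a (n + 2) * z ^ (n + 2)) sums (f z - z))}"

definition zf'_over_f :: "(complex \<Rightarrow> complex) \<Rightarrow> complex \<Rightarrow> complex" where
  "zf'_over_f f z = (if z = 0 then 1 else z * deriv f z / f z)"

text \<open>
  The subscript in the name is not related to the Bessel parameter \<open>p\<close>.  For \<open>\<beta> \<ge> 0\<close> a member
  has no zero in the punctured disc: at such a zero the totalised quotient is \<open>0\<close>, and the
  inequality would read \<open>0 > 1 + \<beta>\<close>.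
\<close>
definition SP_p :: "real \<Rightarrow> real \<Rightarrow> (complex \<Rightarrow> complex) set" where
  "SP_p \<alpha> \<beta> = {f \<in> class_A. \<forall>z\<in>unit_disc.
     Re (exp (- \<i> * of_real \<alpha>) * zf'_over_f f z) > cmod (zf'_over_f f z - 1) + \<beta>}"

definition bessel_kappa :: "complex \<Rightarrow> complex \<Rightarrow> complex" where
  "bessel_kappa p b = p + (b + 1) / 2"

text \<open>Meaningful only if \<open>bessel_kappa p b\<close> is not a nonpositive integer.\<close>
definition bessel_u :: "complex \<Rightarrow> complex \<Rightarrow> complex \<Rightarrow> complex \<Rightarrow> complex" where
  "bessel_u p b c z = (\<Sum>n. (- c / 4) ^ n / (pochhammer (bessel_kappa p b) n * fact n) * z ^ n)"

end

theory Submission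
  imports Defs
begin

text \<open>
  Write \<open>f z = z * u z\<close> with \<open>u z = (\<Sum>n. a n * z ^ n)\<close>, \<open>a 0 = 1\<close>.  Then
  \<open>z * f' z / f z = 1 + w\<close> with \<open>w = z * u' z / u z\<close>, and because
  \<open>Re (exp (-\<i>\<alpha>) * (1 + w)) \<ge> cos \<alpha> - \<bar>w\<bar>\<close>, membership in the class follows once
  \<open>2 * \<bar>w\<bar> < \<delta>\<close>, where \<open>\<delta> = cos \<alpha> - \<beta>\<close>.  Clearing the denominator and using
  \<open>\<bar>u z\<bar> \<ge> 1 - \<bar>u z - 1\<bar>\<close>, it is enough that \<open>2 * \<bar>z * u' z\<bar> + \<delta> * \<bar>u z - 1\<bar> < \<delta>\<close>.
  Both series on the left begin with the power \<open>z ^ 1\<close>, so the left-hand side is at most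
  \<open>\<bar>z\<bar> * (\<Sum>n\<ge>1. (2 * n + \<delta>) * \<bar>a n\<bar>)\<close>.  The factor \<open>\<bar>z\<bar> < 1\<close> supplies the strict
  inequality, and what remains is the coefficient criterion \<open>SP_p_coefficient_criterion\<close>:
  \<open>\<Sum>n\<ge>1. (2 * n + \<delta>) * \<bar>a n\<bar> \<le> \<delta>\<close>.

  For \<open>c < 0\<close> and \<open>\<kappa> > 0\<close> the coefficients of the Bessel function are positive, hence the
  sum in the criterion is \<open>2 * u' 1 + \<delta> * (u 1 - 1)\<close>.  The assumed inequality
  has the weight \<open>2 - cos \<alpha> - \<beta>\<close> in place of \<open>\<delta>\<close>; it is the larger of the two since
  \<open>cos \<alpha> \<le> 1\<close>.
\<close>

section \<open>A coefficient criterion for the class\<close>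

text \<open>
  Keeping the factor \<open>\<bar>z\<bar>\<close> that a missing constant term provides is what later turns the
  non-strict coefficient condition into a strict inequality inside the disc.
\<close>
lemma power_series_tail_norm_le:
  fixes b :: "nat \<Rightarrow> complex"
  assumes "summable (\<lambda>n. cmod (b n))" "cmod z \<le> 1" "(\<lambda>n. b n * z ^ Suc n) sums s"
  shows "cmod s \<le> cmod z * (\<Sum>n. cmod (b n))"
proof -
  have le: "cmod (b n * z ^ Suc n) \<le> cmod z * cmod (b n)" for n
  proof -
    have "cmod z ^ n \<le> 1"
      using assms(2) by (simp add: power_le_one)
    then have "cmod z * cmod (b n) * cmod z ^ n \<le> cmod z * cmod (b n) * 1"
      by (intro mult_left_mono) auto
    then show ?thesis
      by (simp add: norm_mult norm_power mult_ac)
  qed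
  have "cmod (\<Sum>n. b n * z ^ Suc n) \<le> (\<Sum>n. cmod z * cmod (b n))"
    using le summable_mult[OF assms(1)] by (intro norm_suminf_le) auto
  also have "\<dots> = cmod z * (\<Sum>n. cmod (b n))"
    by (rule suminf_mult[OF assms(1)])
  finally show ?thesis
    using assms(3) by (simp add: sums_iff)
qed

lemma power_series_deriv_unit_disc:
  fixes a :: "nat \<Rightarrow> complex"
  assumes u: "\<And>z. z \<in> unit_disc \<Longrightarrow> (\<lambda>n. a n * z ^ n) sums u z"
    and z: "z \<in> unit_disc"
  shows "(u has_field_derivative deriv u z) (at z)"
    and "(\<lambda>n. of_nat (Suc n) * a (Suc n) * z ^ Suc n) sums (z * deriv u z)"
proof -
  have summ: "summable (\<lambda>n. a n * x ^ n)" if "cmod x < 1" for x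
    using u[of x] that by (auto simp: sums_iff)
  have z1: "cmod z < 1"
    using z by simp
  have "((\<lambda>x. \<Sum>n. a n * x ^ n) has_field_derivative (\<Sum>n. diffs a n * z ^ n)) (at z)"
    by (rule termdiffs_strong'[OF summ z1])
  then have D: "(u has_field_derivative (\<Sum>n. diffs a n * z ^ n)) (at z)"
  proof (rule has_field_derivative_transform_within_open)
    show "open unit_disc" "z \<in> unit_disc"
      using z by auto
    show "(\<Sum>n. a n * x ^ n) = u x" if "x \<in> unit_disc" for x
      using u[OF that] by (simp add: sums_iff)
  qed
  then show "(u has_field_derivative deriv u z) (at z)"
    by (simp add: DERIV_imp_deriv)
  have "summable (\<lambda>n. diffs a n * z ^ n)"
    by (rule termdiff_converges[OF z1 summ])
  then have "(\<lambda>n. z * (diffs a n * z ^ n)) sums (z * deriv u z)"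
    using D by (intro sums_mult) (simp add: DERIV_imp_deriv summable_sums)
  then show "(\<lambda>n. of_nat (Suc n) * a (Suc n) * z ^ Suc n) sums (z * deriv u z)"
    by (simp add: diffs_def algebra_simps)
qed

lemma times_power_series_in_class_A:
  fixes a :: "nat \<Rightarrow> complex"
  assumes u: "\<And>z. z \<in> unit_disc \<Longrightarrow> (\<lambda>n. a n * z ^ n) sums u z" and a0: "a 0 = 1"
  shows "(\<lambda>z. z * u z) \<in> class_A"
proof -
  have "u holomorphic_on unit_disc"
    using power_series_deriv_unit_disc(1)[OF u] unfolding holomorphic_on_open[OF open_ball] by blast
  then have "(\<lambda>z. z * u z) analytic_on unit_disc"
    by (subst analytic_on_open) (auto intro!: holomorphic_intros)
  moreover have "(\<lambda>n. a (n + 2 - 1) * z ^ (n + 2)) sums (z * u z - z)" if "z \<in> unit_disc" for z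
  proof -
    have "(\<lambda>n. a (Suc n) * z ^ Suc n) sums (u z - 1)"
      using u[OF that] a0 by (subst sums_Suc_iff) simp
    from sums_mult[OF this, of z] show ?thesis
      by (simp add: algebra_simps)
  qed
  ultimately show ?thesis
    unfolding class_A_def by (auto intro!: exI[of _ "\<lambda>n. a (n - 1)"])
qed

text \<open>
  Turning \<open>1 + w\<close> by the angle \<open>-\<alpha>\<close> costs at most \<open>\<bar>w\<bar>\<close> in the real part, and the
  parabolic condition subtracts \<open>\<bar>w\<bar>\<close> once more; this is the origin of the factor 2.
\<close>
lemma SP_p_I:
  assumes "f \<in> class_A"
    and "\<And>z. z \<in> unit_disc \<Longrightarrow> 2 * cmod (zf'_over_f f z - 1) < cos \<alpha> - \<beta>"
  shows "f \<in> SP_p \<alpha> \<beta>"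
proof -
  have "Re (exp (- \<i> * of_real \<alpha>) * zf'_over_f f z) > cmod (zf'_over_f f z - 1) + \<beta>"
    if z: "z \<in> unit_disc" for z
  proof -
    define e where "e = exp (- \<i> * of_real \<alpha>)"
    define w where "w = zf'_over_f f z - 1"
    have e: "Re e = cos \<alpha>" "cmod e = 1"
      by (simp_all add: e_def Re_exp)
    have "Re (e * zf'_over_f f z) = cos \<alpha> + Re (e * w)"
      using e(1) by (simp add: w_def algebra_simps)
    moreover have "- cmod w \<le> Re (e * w)"
      using abs_Re_le_cmod[of "e * w"] e(2) by (simp add: norm_mult abs_le_iff)
    ultimately show ?thesis
      using assms(2)[OF z] by (simp add: e_def w_def)
  qed
  with assms(1) show ?thesis
    by (auto simp: SP_p_def)
qed

lemma zf'_over_f_times_power_series: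
  fixes a :: "nat \<Rightarrow> complex"
  assumes u: "\<And>z. z \<in> unit_disc \<Longrightarrow> (\<lambda>n. a n * z ^ n) sums u z"
    and z: "z \<in> unit_disc" and nz: "u z \<noteq> 0"
  shows "zf'_over_f (\<lambda>z. z * u z) z - 1 = z * deriv u z / u z"
proof -
  have "((\<lambda>z. z * u z) has_field_derivative (u z + z * deriv u z)) (at z)"
    using power_series_deriv_unit_disc(1)[OF u z]
    by (auto intro!: derivative_eq_intros)
  then show ?thesis
    using nz by (auto simp: zf'_over_f_def DERIV_imp_deriv field_simps)
qed

text \<open>
  The weight \<open>2 * n + (cos \<alpha> - \<beta>)\<close> of \<open>a n\<close> combines the estimate of \<open>z * u' z\<close>, counted twice,
  with that of \<open>u z - 1\<close>.  The second estimate bounds \<open>\<bar>u z\<bar>\<close> from below, so the same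
  inequality that controls the quotient also shows that its denominator does not vanish.
\<close>
lemma SP_p_coefficient_criterion:
  fixes a :: "nat \<Rightarrow> complex"
  assumes u: "\<And>z. z \<in> unit_disc \<Longrightarrow> (\<lambda>n. a n * z ^ n) sums u z" and a0: "a 0 = 1"
    and \<beta>: "\<beta> < cos \<alpha>"
    and S1: "(\<lambda>n. real (Suc n) * cmod (a (Suc n))) sums S1"
    and S0: "(\<lambda>n. cmod (a (Suc n))) sums S0"
    and le: "2 * S1 + (cos \<alpha> - \<beta>) * S0 \<le> cos \<alpha> - \<beta>"
  shows "(\<lambda>z. z * u z) \<in> SP_p \<alpha> \<beta>"
proof (rule SP_p_I)
  show "(\<lambda>z. z * u z) \<in> class_A"
    by (rule times_power_series_in_class_A[OF u a0])
next
  fix z assume z: "z \<in> unit_disc"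
  define \<delta> where "\<delta> = cos \<alpha> - \<beta>"
  have \<delta>: "\<delta> > 0"
    using \<beta> by (simp add: \<delta>_def)
  have z1: "cmod z < 1"
    using z by simp
  have "(\<lambda>n. a (Suc n) * z ^ Suc n) sums (u z - 1)"
    using u[OF z] a0 by (subst sums_Suc_iff) simp
  then have tail: "cmod (u z - 1) \<le> cmod z * S0"
    using power_series_tail_norm_le[of "\<lambda>n. a (Suc n)" z "u z - 1"] S0 z1
    by (simp add: sums_iff)
  have norm_coeff: "cmod (of_nat (Suc n) * a (Suc n)) = real (Suc n) * cmod (a (Suc n))" for n
    by (simp only: norm_mult norm_of_nat)
  have deriv: "cmod (z * deriv u z) \<le> cmod z * S1"
    using power_series_tail_norm_le[of "\<lambda>n. of_nat (Suc n) * a (Suc n)" z "z * deriv u z"]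
      power_series_deriv_unit_disc(2)[OF u z] S1 z1
    unfolding norm_coeff by (simp add: sums_iff)
  have "2 * cmod (z * deriv u z) + \<delta> * cmod (u z - 1) \<le> 2 * (cmod z * S1) + \<delta> * (cmod z * S0)"
    using tail deriv \<delta> by (intro add_mono mult_left_mono) auto
  also have "\<dots> = cmod z * (2 * S1 + \<delta> * S0)"
    by (simp add: algebra_simps)
  also have "\<dots> \<le> cmod z * \<delta>"
    using le by (intro mult_left_mono) (auto simp: \<delta>_def)
  also have "\<dots> < \<delta>"
    using z1 \<delta> by simp
  finally have "2 * cmod (z * deriv u z) < \<delta> * (1 - cmod (u z - 1))"
    by (simp add: algebra_simps)
  also have "\<dots> \<le> \<delta> * cmod (u z)"
    using norm_triangle_ineq4[of "u z" "u z - 1"] \<delta> by (intro mult_left_mono) auto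
  finally have main: "2 * cmod (z * deriv u z) < \<delta> * cmod (u z)" .
  then have nz: "u z \<noteq> 0"
    by auto
  have "2 * cmod (z * deriv u z / u z) < \<delta>"
    using main nz by (simp add: norm_divide divide_less_eq)
  then show "2 * cmod (zf'_over_f (\<lambda>z. z * u z) z - 1) < cos \<alpha> - \<beta>"
    using zf'_over_f_times_power_series[OF u z nz] by (simp add: \<delta>_def)
qed

section \<open>The Bessel series with positive coefficients\<close>

lemma power_le_pochhammer:
  fixes x :: real
  assumes "x > 0"
  shows "x ^ n \<le> pochhammer x n"
proof -
  have "(\<Prod>i = 0..<n. x) \<le> (\<Prod>i = 0..<n. x + real i)"
    using assms by (intro prod_mono) auto
  then show ?thesis
    by (simp add: pochhammer_prod)
qed

definition bessel_coeff :: "real \<Rightarrow> real \<Rightarrow> nat \<Rightarrow> real" where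
  "bessel_coeff \<kappa> c n = (- c / 4) ^ n / (pochhammer \<kappa> n * fact n)"

lemma bessel_coeff_pos:
  assumes "c < 0" "\<kappa> > 0"
  shows "bessel_coeff \<kappa> c n > 0"
  using assms by (simp add: bessel_coeff_def pochhammer_pos)

text \<open>The bound \<open>(\<kappa>)\<^sub>n \<ge> \<kappa> ^ n\<close> makes an exponential series a majorant.\<close>
lemma summable_bessel:
  assumes "c < 0" "\<kappa> > 0"
  shows "summable (\<lambda>n. complex_of_real (bessel_coeff \<kappa> c n) * z ^ n)"
proof (rule summable_comparison_test')
  define x where "x = - c / 4 / \<kappa> * cmod z"
  show "summable (\<lambda>n. x ^ n / fact n)"
    using summable_exp[of x] by (simp add: divide_inverse mult.commute)
  show "norm (complex_of_real (bessel_coeff \<kappa> c n) * z ^ n) \<le> x ^ n / fact n" for n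
  proof -
    have "bessel_coeff \<kappa> c n \<le> (- c / 4) ^ n / (\<kappa> ^ n * fact n)"
      unfolding bessel_coeff_def using assms power_le_pochhammer[of \<kappa> n]
      by (intro divide_left_mono mult_right_mono mult_pos_pos) (auto simp: pochhammer_pos)
    then have "bessel_coeff \<kappa> c n * cmod z ^ n \<le> (- c / 4) ^ n / (\<kappa> ^ n * fact n) * cmod z ^ n"
      by (intro mult_right_mono) auto
    also have "\<dots> = x ^ n / fact n"
      by (simp only: x_def power_mult_distrib power_divide times_divide_eq_left divide_divide_eq_left)
    finally show ?thesis
      using bessel_coeff_pos[OF assms, of n] by (simp add: norm_mult norm_power)
  qed
qed

lemma bessel_u_sums:
  assumes "c < 0" "\<kappa> > 0" "bessel_kappa p b = of_real \<kappa>"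
  shows "(\<lambda>n. complex_of_real (bessel_coeff \<kappa> c n) * z ^ n) sums bessel_u p b (of_real c) z"
proof -
  have "bessel_u p b (of_real c) z = (\<Sum>n. complex_of_real (bessel_coeff \<kappa> c n) * z ^ n)"
    by (simp add: bessel_u_def bessel_coeff_def assms(3) pochhammer_of_real)
  then show ?thesis
    using summable_bessel[OF assms(1,2)] by (simp add: summable_sums)
qed

lemma bessel_coeff_sums_at_1:
  assumes "c < 0" "\<kappa> > 0" "bessel_kappa p b = of_real \<kappa>"
  shows "(\<lambda>n. bessel_coeff \<kappa> c (Suc n)) sums (Re (bessel_u p b (of_real c) 1) - 1)"
proof -
  have "(\<lambda>n. bessel_coeff \<kappa> c n) sums Re (bessel_u p b (of_real c) 1)"
    using sums_Re[OF bessel_u_sums[OF assms, of 1]] by simp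
  moreover have "bessel_coeff \<kappa> c 0 = 1"
    by (simp add: bessel_coeff_def)
  ultimately show ?thesis
    by (subst sums_Suc_iff) simp
qed

lemma bessel_coeff_sums_deriv_at_1:
  assumes "c < 0" "\<kappa> > 0" "bessel_kappa p b = of_real \<kappa>"
  shows "(\<lambda>n. real (Suc n) * bessel_coeff \<kappa> c (Suc n)) sums Re (deriv (bessel_u p b (of_real c)) 1)"
proof -
  let ?a = "\<lambda>n. complex_of_real (bessel_coeff \<kappa> c n)"
  have eq: "bessel_u p b (of_real c) = (\<lambda>z. \<Sum>n. ?a n * z ^ n)"
    using bessel_u_sums[OF assms] by (auto simp: sums_iff)
  have "(bessel_u p b (of_real c) has_field_derivative (\<Sum>n. diffs ?a n * 1 ^ n)) (at 1)"
    unfolding eq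
    by (rule termdiffs_strong_converges_everywhere[OF summable_bessel[OF assms(1,2)]])
  moreover have "summable (\<lambda>n. diffs ?a n * 1 ^ n)"
    by (rule termdiff_converges_all[OF summable_bessel[OF assms(1,2)]])
  ultimately have "(\<lambda>n. diffs ?a n) sums deriv (bessel_u p b (of_real c)) 1"
    by (simp add: DERIV_imp_deriv summable_sums)
  from sums_Re[OF this] show ?thesis
    by (simp add: diffs_def)
qed

theorem theorem2p1:
  fixes \<alpha> \<beta> c \<kappa> :: real and p b :: complex
  assumes "\<bar>\<alpha>\<bar> < pi / 2" and "0 \<le> \<beta>" and "\<beta> < 1"
    and "c < 0"
    and "bessel_kappa p b = of_real \<kappa>" and "\<kappa> > 0"
    and "2 * Re (deriv (bessel_u p b (of_real c)) 1)
           + (2 - cos \<alpha> - \<beta>) * (Re (bessel_u p b (of_real c) 1) - 1) \<le> cos \<alpha> - \<beta>"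
  shows "(\<lambda>z. z * bessel_u p b (of_real c) z) \<in> SP_p \<alpha> \<beta>"
proof -
  define S1 where "S1 = Re (deriv (bessel_u p b (of_real c)) 1)"
  define S0 where "S0 = Re (bessel_u p b (of_real c) 1) - 1"
  note bessel = assms(4,6,5)
  have pos: "bessel_coeff \<kappa> c n > 0" for n
    by (rule bessel_coeff_pos[OF assms(4,6)])
  have S1: "(\<lambda>n. real (Suc n) * bessel_coeff \<kappa> c (Suc n)) sums S1"
    unfolding S1_def by (rule bessel_coeff_sums_deriv_at_1[OF bessel])
  have S0: "(\<lambda>n. bessel_coeff \<kappa> c (Suc n)) sums S0"
    unfolding S0_def by (rule bessel_coeff_sums_at_1[OF bessel])
  have "S1 > 0"
    using S1 pos suminf_pos[of "\<lambda>n. real (Suc n) * bessel_coeff \<kappa> c (Suc n)"]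
    by (simp add: sums_iff)
  have "S0 > 0"
    using S0 pos suminf_pos[of "\<lambda>n. bessel_coeff \<kappa> c (Suc n)"] by (simp add: sums_iff)
  have hyp: "2 * S1 + (2 - cos \<alpha> - \<beta>) * S0 \<le> cos \<alpha> - \<beta>"
    using assms(7) by (simp add: S1_def S0_def)
  have weight: "cos \<alpha> - \<beta> \<le> 2 - cos \<alpha> - \<beta>" "0 < 2 - cos \<alpha> - \<beta>"
    using cos_le_one[of \<alpha>] assms(3) by linarith+
  \<comment> \<open>A positive left-hand side of the hypothesis already forces \<open>\<beta> < cos \<alpha>\<close>.\<close>
  have "0 < (2 - cos \<alpha> - \<beta>) * S0"
    using weight(2) \<open>S0 > 0\<close> by simp
  then have \<beta>: "\<beta> < cos \<alpha>"
    using hyp \<open>S1 > 0\<close> by linarith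
  have "(cos \<alpha> - \<beta>) * S0 \<le> (2 - cos \<alpha> - \<beta>) * S0"
    using weight(1) \<open>S0 > 0\<close> by (intro mult_right_mono) auto
  then have le: "2 * S1 + (cos \<alpha> - \<beta>) * S0 \<le> cos \<alpha> - \<beta>"
    using hyp by linarith
  have norm: "cmod (complex_of_real (bessel_coeff \<kappa> c n)) = bessel_coeff \<kappa> c n" for n
    using pos[of n] by simp
  show ?thesis
  proof (rule SP_p_coefficient_criterion[OF bessel_u_sums[OF bessel] _ \<beta> _ _ le])
    show "complex_of_real (bessel_coeff \<kappa> c 0) = 1"
      by (simp add: bessel_coeff_def)
  qed (use S1 S0 in \<open>simp_all only: norm\<close>)
qed

end
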